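(* Let $\gamma>1$ be a real number. Consider the control system $\dot{x}_1=x_2$, $\dot{x}_2=-u\,x_1$ and the following minimum-time problem: among all admissible controls $u:[0,T]\to[-1,1]$ (Lebesgue measurable, with $T>0$ free) for which the trajectory starting from $(x_1(0),x_2(0))=(1,0)$ satisfies $x_1(t)>0$ for all $t\in[0,T]$ and reaches $(x_1(T),x_2(T))=(\gamma,0)$, find the one with minimum $T$. Then the optimal trajectory for this problem has the one-switching form $XY$ (an $X$-trajectory, $u=-1$, followed by a $Y$-trajectory, $u=1$). The optimal control is $$u(t)=\begin{cases}-1, & 0<t<T_X,\\ 1, & T_X<t<T_X+T_Y,\end{cases}$$ where $$T_X=\sinh^{-1}\left(\sqrt{\frac{\gamma^2-1}{2}}\right),\qquad T_Y=\sin^{-1}\left(\frac{1}{\gamma}\sqrt{\frac{\gamma^2-1}{2}}\right),$$ and the minimum time is $T=T_X+T_Y$.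
   Context: The state space is $\mathcal{D}=\{(x_1,x_2)\in\mathbb{R}^2: x_1>0\}$ and the control set is $U=[-1,1]$. The system is written $\dot{x}=f(x)+u\,g(x)$ with $f(x)=(x_2,0)^{T}$ and $g(x)=(0,-x_1)^{T}$. Admissible controls are Lebesgue measurable functions on an interval $[0,T]$ with values in $U$; controls are identified when they agree almost everywhere. The trajectory corresponding to an admissible control $u$ is the (absolutely continuous) solution $x$ of the system for that control. A control (with its trajectory) is optimal if it is feasible, i.e. its trajectory satisfies the stated boundary conditions and the constraint $x_1(t)>0$, and no feasible control has a smaller final time $T$. "The optimal control is $u$" means that $u$ is feasible and attains the minimum time, and that it is the optimal control up to the almost-everywhere identification. $X=f-g$ and $Y=f+g$ denote the vector fields corresponding to the constant controls $u=-1$ and $u=1$; their trajectories are called $X$- and $Y$-trajectories, and $XY$ denotes the concatenation of an $X$-trajectory followed by a $Y$-trajectory. $\sinh^{-1}$ is the inverse hyperbolic sine and $\sin^{-1}$ is the principal arcsine, with values in $[-\pi/2,\pi/2]$. *)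

theory Defs
  imports "HOL-Analysis.Analysis"
begin

text \<open>
  Absolute continuity on a compact interval in the usual \<open>\<epsilon>\<close>-\<open>\<delta>\<close> sense. A division of its own union
  is just a finite family of non-overlapping compact intervals \<open>K = {Inf K..Sup K}\<close>.
\<close>

definition abs_continuous_on :: "real \<Rightarrow> real \<Rightarrow> (real \<Rightarrow> 'a::real_normed_vector) \<Rightarrow> bool" where
  "abs_continuous_on a b h \<longleftrightarrow>
     (\<forall>\<epsilon>>0. \<exists>\<delta>>0. \<forall>\<D>. \<D> division_of \<Union>\<D> \<and> \<Union>\<D> \<subseteq> {a..b} \<and> (\<Sum>K\<in>\<D>. Sup K - Inf K) < \<delta>
        \<longrightarrow> (\<Sum>K\<in>\<D>. norm (h (Sup K) - h (Inf K))) < \<epsilon>)"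

definition state_space :: "(real \<times> real) set" where
  "state_space = {p. fst p > 0}"

definition f_field :: "real \<times> real \<Rightarrow> real \<times> real" where
  "f_field p = (snd p, 0)"

definition g_field :: "real \<times> real \<Rightarrow> real \<times> real" where
  "g_field p = (0, - fst p)"

definition X_field :: "real \<times> real \<Rightarrow> real \<times> real" where
  "X_field p = f_field p - g_field p"

definition Y_field :: "real \<times> real \<Rightarrow> real \<times> real" where
  "Y_field p = f_field p + g_field p"

text \<open>
  Controls and trajectories are total functions on the reals, but only their values on \<open>{0..T}\<close>
  are constrained.
\<close>

definition admissible :: "real \<Rightarrow> (real \<Rightarrow> real) \<Rightarrow> bool" where
  "admissible T u \<longleftrightarrow>
     u \<in> borel_measurable (lebesgue_on {0..T}) \<and> (\<forall>t\<in>{0..T}. u t \<in> {-1..1})"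

definition trajectory :: "real \<Rightarrow> (real \<Rightarrow> real) \<Rightarrow> (real \<Rightarrow> real \<times> real) \<Rightarrow> bool" where
  "trajectory T u x \<longleftrightarrow>
     abs_continuous_on 0 T x \<and>
     (AE t in lebesgue_on {0..T}.
        (x has_vector_derivative f_field (x t) + u t *\<^sub>R g_field (x t)) (at t within {0..T}))"

definition feasible :: "real \<Rightarrow> real \<Rightarrow> (real \<Rightarrow> real) \<Rightarrow> (real \<Rightarrow> real \<times> real) \<Rightarrow> bool" where
  "feasible \<gamma> T u x \<longleftrightarrow>
     0 < T \<and> admissible T u \<and> trajectory T u x \<and> x 0 = (1, 0) \<and> x T = (\<gamma>, 0) \<and>
     (\<forall>t\<in>{0..T}. x t \<in> state_space)"

definition optimal :: "real \<Rightarrow> real \<Rightarrow> (real \<Rightarrow> real) \<Rightarrow> (real \<Rightarrow> real \<times> real) \<Rightarrow> bool" where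
  "optimal \<gamma> T u x \<longleftrightarrow>
     feasible \<gamma> T u x \<and> (\<forall>T' u' x'. feasible \<gamma> T' u' x' \<longrightarrow> T \<le> T')"

definition integral_curve ::
    "(real \<times> real \<Rightarrow> real \<times> real) \<Rightarrow> real \<Rightarrow> real \<Rightarrow> (real \<Rightarrow> real \<times> real) \<Rightarrow> bool" where
  "integral_curve F a b x \<longleftrightarrow>
     (\<forall>t\<in>{a..b}. (x has_vector_derivative F (x t)) (at t within {a..b}))"

text \<open>One switching, at time \<open>s\<close>; both arcs have positive duration.\<close>

definition XY_trajectory :: "real \<Rightarrow> real \<Rightarrow> (real \<Rightarrow> real \<times> real) \<Rightarrow> bool" where
  "XY_trajectory s T x \<longleftrightarrow>
     0 < s \<and> s < T \<and> integral_curve X_field 0 s x \<and> integral_curve Y_field s T x"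

end

theory Submission
  imports Defs
begin

text \<open>
  The velocity ratio \<open>w = x\<^sub>2 / x\<^sub>1\<close> satisfies the Riccati equation \<open>w' = - u - w\<^sup>2\<close>, vanishes at both ends, and
  has integral \<open>ln \<gamma>\<close>. Since \<open>- 1 \<le> u \<le> 1\<close>, it cannot rise faster than with \<open>u = - 1\<close> and must fall back
  to \<open>0\<close> no faster than with \<open>u = 1\<close>, so \<open>w t \<le> min (tanh t) (tan (T - t))\<close> (the second bound as long as
  \<open>T - t < pi / 2\<close>). The XY control keeps \<open>w\<close> on this envelope at all times, and any other control needs
  longer to accumulate the logarithmic growth \<open>ln \<gamma>\<close>.

  The proof uses this argument in linear form. Instead of bounding \<open>w\<close>, it compares \<open>x\<^sub>1\<close> with
  a positive solution \<open>y\<close> for an extreme constant control by means of the Wronskian \<open>x\<^sub>2 y - x\<^sub>1 y'\<close>. The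
  Wronskian with \<open>y = cosh t\<close> decreases from \<open>0\<close> at time \<open>0\<close>, the one with \<open>y = cos (T - t)\<close> increases to \<open>0\<close>
  at time \<open>T\<close>; hence both are nonpositive and \<open>x\<^sub>1 / y\<close> is nonincreasing. This gives
  \<open>\<gamma> * cos (T - t) \<le> x\<^sub>1 t \<le> cosh t\<close>, and evaluation at \<open>t = T - T\<^sub>Y\<close>, where the left side is \<open>cosh T\<^sub>X\<close>,
  yields \<open>T \<ge> T\<^sub>X + T\<^sub>Y\<close>. Equality makes the ratio constant on each arc, which determines the trajectory
  and, almost everywhere, the control (\<open>ratio_rigidity\<close>, \<open>feasible_within_bound_is_extremal\<close>).
  Conversely, the two arcs glue to a feasible trajectory of duration \<open>T\<^sub>X + T\<^sub>Y\<close> (\<open>bang_bang_feasible\<close>).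

  Controls are only measurable, so the Wronskian is only absolutely continuous and its derivative is
  known only almost everywhere. The analytic ingredient is that this still controls its monotonicity
  (\<open>abs_continuous_on_nondecreasing\<close>).
\<close>

section \<open>Absolutely continuous functions\<close>

lemma abs_continuous_on_subset:
  assumes "abs_continuous_on a b h" "{c..d} \<subseteq> {a..b}"
  shows "abs_continuous_on c d h"
  using assms unfolding abs_continuous_on_def by (meson subset_trans)

lemma division_of_real_interval:
  fixes K :: "real set"
  assumes "\<D> division_of S" "S \<subseteq> {a..b}" "K \<in> \<D>"
  shows "Inf K \<le> Sup K" "Inf K \<in> {a..b}" "Sup K \<in> {a..b}" "K = {Inf K..Sup K}"
proof -
  obtain c d where K: "K = {c..d}"
    using division_ofD(4)[OF assms(1,3)] by auto
  have "K \<noteq> {}" "K \<subseteq> {a..b}"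
    using division_ofD(2,3)[OF assms(1,3)] assms(2) by auto
  then show "Inf K \<le> Sup K" "Inf K \<in> {a..b}" "Sup K \<in> {a..b}" "K = {Inf K..Sup K}"
    using K by auto
qed

lemma abs_continuous_on_imp_continuous_on:
  assumes h: "abs_continuous_on a b h"
  shows "continuous_on {a..b} h"
  unfolding continuous_on_iff
proof (intro ballI allI impI)
  fix s and \<epsilon> :: real assume s: "s \<in> {a..b}" and "\<epsilon> > 0"
  then obtain \<delta> where "\<delta> > 0" and \<delta>:
    "\<And>\<D>. \<D> division_of \<Union>\<D> \<Longrightarrow> \<Union>\<D> \<subseteq> {a..b} \<Longrightarrow> (\<Sum>K\<in>\<D>. Sup K - Inf K) < \<delta>
       \<Longrightarrow> (\<Sum>K\<in>\<D>. norm (h (Sup K) - h (Inf K))) < \<epsilon>"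
    using h unfolding abs_continuous_on_def by meson
  have ordered: "norm (h d - h c) < \<epsilon>" if "c \<le> d" "{c..d} \<subseteq> {a..b}" "d - c < \<delta>" for c d
  proof -
    have "{{c..d}} division_of \<Union>{{c..d}}"
      using that(1) division_of_self[of c d] by simp
    from \<delta>[OF this] show ?thesis using that by simp
  qed
  have "dist (h t) (h s) < \<epsilon>" if "t \<in> {a..b}" "dist t s < \<delta>" for t
    using ordered[of s t] ordered[of t s] that s
    by (cases "s \<le> t") (auto simp: dist_norm norm_minus_commute)
  then show "\<exists>d>0. \<forall>x'\<in>{a..b}. dist x' s < d \<longrightarrow> dist (h x') (h s) < \<epsilon>"
    using \<open>\<delta> > 0\<close> by blast
qed

lemma lipschitz_imp_abs_continuous_on:
  assumes "L-lipschitz_on {a..b} h"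
  shows "abs_continuous_on a b h"
  unfolding abs_continuous_on_def
proof (intro allI impI)
  fix \<epsilon> :: real assume "\<epsilon> > 0"
  have "L \<ge> 0" using assms by (rule lipschitz_on_nonneg)
  show "\<exists>\<delta>>0. \<forall>\<D>. \<D> division_of \<Union>\<D> \<and> \<Union>\<D> \<subseteq> {a..b} \<and> (\<Sum>K\<in>\<D>. Sup K - Inf K) < \<delta>
          \<longrightarrow> (\<Sum>K\<in>\<D>. norm (h (Sup K) - h (Inf K))) < \<epsilon>"
  proof (intro exI[of _ "\<epsilon> / (L + 1)"] conjI allI impI)
    show "0 < \<epsilon> / (L + 1)" using \<open>\<epsilon> > 0\<close> \<open>L \<ge> 0\<close> by simp
    fix \<D> assume \<D>: "\<D> division_of \<Union>\<D> \<and> \<Union>\<D> \<subseteq> {a..b} \<and> (\<Sum>K\<in>\<D>. Sup K - Inf K) < \<epsilon> / (L + 1)"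
    have nonneg: "0 \<le> (\<Sum>K\<in>\<D>. Sup K - Inf K)"
      using \<D> division_of_real_interval(1)[of \<D> "\<Union>\<D>" a b] by (intro sum_nonneg) simp
    have "(\<Sum>K\<in>\<D>. norm (h (Sup K) - h (Inf K))) \<le> (\<Sum>K\<in>\<D>. L * (Sup K - Inf K))"
    proof (rule sum_mono)
      fix K assume "K \<in> \<D>"
      then show "norm (h (Sup K) - h (Inf K)) \<le> L * (Sup K - Inf K)"
        using lipschitz_onD[OF assms, of "Sup K" "Inf K"] division_of_real_interval[of \<D> "\<Union>\<D>" a b K] \<D>
        by (simp add: dist_norm)
    qed
    also have "\<dots> = L * (\<Sum>K\<in>\<D>. Sup K - Inf K)"
      by (simp add: sum_distrib_left)
    also have "\<dots> \<le> (L + 1) * (\<Sum>K\<in>\<D>. Sup K - Inf K)"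
      using nonneg by (simp add: mult_right_mono)
    also have "\<dots> < \<epsilon>"
      using \<D> \<open>L \<ge> 0\<close> by (simp add: field_simps)
    finally show "(\<Sum>K\<in>\<D>. norm (h (Sup K) - h (Inf K))) < \<epsilon>" .
  qed
qed

text \<open>
  The Lipschitz form is kept because Lipschitz functions on adjacent intervals can be glued,
  which makes a bang-bang trajectory absolutely continuous although it is not \<open>C\<^sup>1\<close>.
\<close>

lemma C1_imp_lipschitz_on:
  fixes h :: "real \<Rightarrow> 'a::real_normed_vector"
  assumes deriv: "\<And>t. t \<in> {a..b} \<Longrightarrow> (h has_vector_derivative h' t) (at t within {a..b})"
    and cont: "continuous_on {a..b} h'"
  obtains L where "L-lipschitz_on {a..b} h"
proof -
  have "bounded (h' ` {a..b})"
    using cont compact_continuous_image compact_imp_bounded by blast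
  then obtain B where B: "B > 0" "\<And>t. t \<in> {a..b} \<Longrightarrow> norm (h' t) \<le> B"
    unfolding bounded_pos by auto
  have "norm (h t - h s) \<le> B * norm (t - s)" if "s \<in> {a..b}" "t \<in> {a..b}" for s t
  proof (rule differentiable_bound[of "{a..b}" h "\<lambda>t r. r *\<^sub>R h' t"])
    show "onorm (\<lambda>r. r *\<^sub>R h' t) \<le> B" if "t \<in> {a..b}" for t
    proof (rule onorm_le)
      show "norm (r *\<^sub>R h' t) \<le> B * norm r" for r
        using mult_left_mono[OF B(2)[OF that], of "\<bar>r\<bar>"] by (simp add: mult.commute)
    qed
  qed (use that deriv in \<open>auto simp: has_vector_derivative_def\<close>)
  then have "B-lipschitz_on {a..b} h"
    using B(1) by (intro lipschitz_onI) (auto simp: dist_norm)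
  then show thesis by (rule that)
qed

corollary C1_imp_abs_continuous_on:
  fixes h :: "real \<Rightarrow> 'a::real_normed_vector"
  assumes "\<And>t. t \<in> {a..b} \<Longrightarrow> (h has_vector_derivative h' t) (at t within {a..b})"
    and "continuous_on {a..b} h'"
  shows "abs_continuous_on a b h"
  using C1_imp_lipschitz_on[OF assms] lipschitz_imp_abs_continuous_on by blast

text \<open>
  The common core of the closure properties below: a function whose increments are controlled by those
  of two absolutely continuous functions inherits their modulus.
\<close>

lemma abs_continuous_on_dominated:
  fixes p :: "real \<Rightarrow> 'c::real_normed_vector"
  assumes f: "abs_continuous_on a b f" and g: "abs_continuous_on a b g" and "M > 0"
    and dom: "\<And>s t. s \<in> {a..b} \<Longrightarrow> t \<in> {a..b} \<Longrightarrow>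
                norm (p t - p s) \<le> M * (norm (f t - f s) + norm (g t - g s))"
  shows "abs_continuous_on a b p"
  unfolding abs_continuous_on_def
proof (intro allI impI)
  fix \<epsilon> :: real assume "\<epsilon> > 0"
  define \<eta> where "\<eta> = \<epsilon> / (2 * M)"
  have "\<eta> > 0" using \<open>\<epsilon> > 0\<close> \<open>M > 0\<close> by (simp add: \<eta>_def)
  obtain \<delta>f where "\<delta>f > 0" and \<delta>f:
    "\<And>\<D>. \<D> division_of \<Union>\<D> \<and> \<Union>\<D> \<subseteq> {a..b} \<and> (\<Sum>K\<in>\<D>. Sup K - Inf K) < \<delta>f
       \<Longrightarrow> (\<Sum>K\<in>\<D>. norm (f (Sup K) - f (Inf K))) < \<eta>"
    using f \<open>\<eta> > 0\<close> unfolding abs_continuous_on_def by meson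
  obtain \<delta>g where "\<delta>g > 0" and \<delta>g:
    "\<And>\<D>. \<D> division_of \<Union>\<D> \<and> \<Union>\<D> \<subseteq> {a..b} \<and> (\<Sum>K\<in>\<D>. Sup K - Inf K) < \<delta>g
       \<Longrightarrow> (\<Sum>K\<in>\<D>. norm (g (Sup K) - g (Inf K))) < \<eta>"
    using g \<open>\<eta> > 0\<close> unfolding abs_continuous_on_def by meson
  show "\<exists>\<delta>>0. \<forall>\<D>. \<D> division_of \<Union>\<D> \<and> \<Union>\<D> \<subseteq> {a..b} \<and> (\<Sum>K\<in>\<D>. Sup K - Inf K) < \<delta>
          \<longrightarrow> (\<Sum>K\<in>\<D>. norm (p (Sup K) - p (Inf K))) < \<epsilon>"
  proof (intro exI[of _ "min \<delta>f \<delta>g"] conjI allI impI)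
    show "0 < min \<delta>f \<delta>g" using \<open>\<delta>f > 0\<close> \<open>\<delta>g > 0\<close> by simp
    fix \<D> assume \<D>: "\<D> division_of \<Union>\<D> \<and> \<Union>\<D> \<subseteq> {a..b} \<and> (\<Sum>K\<in>\<D>. Sup K - Inf K) < min \<delta>f \<delta>g"
    have "(\<Sum>K\<in>\<D>. norm (p (Sup K) - p (Inf K)))
        \<le> (\<Sum>K\<in>\<D>. M * (norm (f (Sup K) - f (Inf K)) + norm (g (Sup K) - g (Inf K))))"
      using \<D> division_of_real_interval[of \<D> "\<Union>\<D>" a b] by (intro sum_mono dom) simp_all
    also have "\<dots> = M * ((\<Sum>K\<in>\<D>. norm (f (Sup K) - f (Inf K))) + (\<Sum>K\<in>\<D>. norm (g (Sup K) - g (Inf K))))"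
      by (simp add: sum_distrib_left sum.distrib distrib_left)
    also have "\<dots> < M * (\<eta> + \<eta>)"
      using \<delta>f[of \<D>] \<delta>g[of \<D>] \<D> \<open>M > 0\<close> by (intro mult_strict_left_mono add_strict_mono) auto
    also have "\<dots> = \<epsilon>" using \<open>M > 0\<close> by (simp add: \<eta>_def)
    finally show "(\<Sum>K\<in>\<D>. norm (p (Sup K) - p (Inf K))) < \<epsilon>" .
  qed
qed

lemma abs_continuous_on_diff:
  assumes "abs_continuous_on a b f" "abs_continuous_on a b g"
  shows "abs_continuous_on a b (\<lambda>t. f t - g t)"
proof (rule abs_continuous_on_dominated[OF assms, of 1])
  show "norm (f t - g t - (f s - g s)) \<le> 1 * (norm (f t - f s) + norm (g t - g s))" for s t
    using norm_triangle_ineq4[of "f t - f s" "g t - g s"] by (simp add: algebra_simps)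
qed simp

lemma abs_continuous_on_mult:
  fixes f g :: "real \<Rightarrow> real"
  assumes f: "abs_continuous_on a b f" and g: "abs_continuous_on a b g"
  shows "abs_continuous_on a b (\<lambda>t. f t * g t)"
proof -
  have "bounded (f ` {a..b} \<union> g ` {a..b})"
    using f g abs_continuous_on_imp_continuous_on compact_continuous_image compact_imp_bounded
    by (metis bounded_Un compact_Icc)
  then obtain M where "M > 0" and M: "\<And>t. t \<in> {a..b} \<Longrightarrow> \<bar>f t\<bar> \<le> M \<and> \<bar>g t\<bar> \<le> M"
    unfolding bounded_pos by auto
  show ?thesis
  proof (rule abs_continuous_on_dominated[OF f g \<open>M > 0\<close>])
    fix s t assume st: "s \<in> {a..b}" "t \<in> {a..b}"
    have "norm (f t * g t - f s * g s) = \<bar>(f t - f s) * g t + f s * (g t - g s)\<bar>"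
      by (simp add: algebra_simps)
    also have "\<dots> \<le> \<bar>f t - f s\<bar> * \<bar>g t\<bar> + \<bar>f s\<bar> * \<bar>g t - g s\<bar>"
      by (metis abs_mult abs_triangle_ineq)
    also have "\<dots> \<le> \<bar>f t - f s\<bar> * M + M * \<bar>g t - g s\<bar>"
      using M st \<open>M > 0\<close> by (intro add_mono mult_mono) auto
    finally show "norm (f t * g t - f s * g s) \<le> M * (norm (f t - f s) + norm (g t - g s))"
      by (simp add: algebra_simps)
  qed
qed

lemma abs_continuous_on_fst_snd:
  assumes "abs_continuous_on a b x"
  shows "abs_continuous_on a b (\<lambda>t. fst (x t))" "abs_continuous_on a b (\<lambda>t. snd (x t))"
proof -
  have "norm (fst (x t) - fst (x s)) \<le> norm (x t - x s)"
    "norm (snd (x t) - snd (x s)) \<le> norm (x t - x s)" for s t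
    using norm_fst_le[of "fst (x t - x s)" "snd (x t - x s)"]
      norm_snd_le[of "snd (x t - x s)" "fst (x t - x s)"]
    unfolding prod.collapse by simp_all
  then have "norm (fst (x t) - fst (x s)) \<le> 1 * (norm (x t - x s) + norm (x t - x s))"
    "norm (snd (x t) - snd (x s)) \<le> 1 * (norm (x t - x s) + norm (x t - x s))" for s t
    by (simp_all only: mult_1 add_increasing2 norm_ge_zero)
  then show "abs_continuous_on a b (\<lambda>t. fst (x t))" "abs_continuous_on a b (\<lambda>t. snd (x t))"
    by (auto intro: abs_continuous_on_dominated[OF assms assms zero_less_one])
qed

section \<open>Monotonicity and primitives from an almost everywhere derivative\<close>

text \<open>
  The straddle form of differentiability: it bounds the increment over an interval that contains
  \<open>t\<close> rather than starting at \<open>t\<close>, and is therefore usable with tagged divisions.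
\<close>

lemma nonneg_derivative_lower_bound_nearby:
  fixes h :: "real \<Rightarrow> real"
  assumes "(h has_real_derivative D) (at t within S)" "D \<ge> 0" "\<epsilon> > 0"
  obtains r where "r > 0"
    "\<And>c d. c \<in> S \<Longrightarrow> d \<in> S \<Longrightarrow> {c..d} \<subseteq> ball t r \<Longrightarrow> t \<in> {c..d} \<Longrightarrow> h d - h c \<ge> - \<epsilon> * (d - c)"
proof -
  obtain r where "r > 0" and
    r: "\<And>y. y \<in> S \<Longrightarrow> norm (y - t) < r \<Longrightarrow> norm (h y - h t - D * (y - t)) \<le> \<epsilon> * norm (y - t)"
    using assms(1,3) unfolding has_field_derivative_def has_derivative_within_alt by meson
  have "h d - h c \<ge> - \<epsilon> * (d - c)"
    if "c \<in> S" "d \<in> S" "{c..d} \<subseteq> ball t r" "t \<in> {c..d}" for c d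
  proof -
    have "c \<in> {c..d}" "d \<in> {c..d}" using that(4) by auto
    then have "norm (c - t) < r" "norm (d - t) < r"
      using that(3) by (auto simp: dist_norm norm_minus_commute subset_iff)
    then have "h d - h t - D * (d - t) \<ge> - \<epsilon> * (d - t)" "h c - h t - D * (c - t) \<le> \<epsilon> * (t - c)"
      using r[of d] r[of c] that by auto
    moreover have "D * (d - c) \<ge> 0" using that assms(2) by auto
    ultimately show ?thesis by (simp add: algebra_simps)
  qed
  with \<open>r > 0\<close> show thesis by (rule that)
qed

text \<open>
  Fix \<open>\<epsilon>\<close> and cover the exceptional null set by an open set \<open>U\<close> of measure below the \<open>\<delta>\<close> of absolute
  continuity. Choose a gauge that keeps intervals with an exceptional tag inside \<open>U\<close> and makes the
  straddle estimate hold for all other tags. In the telescoping sum of a fine tagged division, the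
  intervals of the first kind have total length less than \<open>\<delta>\<close> and contribute at least \<open>- \<epsilon>\<close>; the
  others contribute at least \<open>- \<epsilon> * (b - a)\<close>.
\<close>

lemma abs_continuous_on_nondecreasing:
  fixes h :: "real \<Rightarrow> real"
  assumes h: "abs_continuous_on a b h" and N: "negligible N" and "a \<le> b"
    and deriv: "\<And>t. t \<in> {a..b} - N \<Longrightarrow> \<exists>D\<ge>0. (h has_real_derivative D) (at t within {a..b})"
  shows "h a \<le> h b"
proof -
  have almost: "h b - h a \<ge> - \<epsilon> * (b - a) - \<epsilon>" if "\<epsilon> > 0" for \<epsilon>
  proof -
    obtain \<delta> where "\<delta> > 0" and \<delta>:
      "\<And>\<D>. \<D> division_of \<Union>\<D> \<and> \<Union>\<D> \<subseteq> {a..b} \<and> (\<Sum>K\<in>\<D>. Sup K - Inf K) < \<delta>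
         \<Longrightarrow> (\<Sum>K\<in>\<D>. norm (h (Sup K) - h (Inf K))) < \<epsilon>"
      using h \<open>\<epsilon> > 0\<close> unfolding abs_continuous_on_def by meson
    obtain U where U: "open U" "N \<subseteq> U" "U \<in> lmeasurable" "measure lebesgue U < \<delta>"
    proof -
      obtain U where U: "open U" "N \<subseteq> U" "U - N \<in> lmeasurable" "emeasure lebesgue (U - N) < ennreal \<delta>"
        using sets_lebesgue_outer_open[of N \<delta>] N \<open>\<delta> > 0\<close> negligible_imp_sets by blast
      have "U = (U - N) \<union> N" using U(2) by blast
      then have "U \<in> lmeasurable"
        using U(3) negligible_imp_measurable[OF N] by (metis fmeasurable.Un)
      moreover have "measure lebesgue (U - N) < \<delta>"
        using U(3,4) \<open>\<delta> > 0\<close> by (simp add: emeasure_eq_measure2 ennreal_less_iff)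
      then have "measure lebesgue U < \<delta>"
        using N calculation by (simp add: measure_Diff_null_set negligible_iff_null_sets fmeasurableD)
      ultimately show thesis using U that by blast
    qed
    have "\<exists>r>0. (t \<in> N \<longrightarrow> ball t r \<subseteq> U) \<and>
            (t \<in> {a..b} - N \<longrightarrow> (\<forall>c\<in>{a..b}. \<forall>d\<in>{a..b}. {c..d} \<subseteq> ball t r \<longrightarrow> t \<in> {c..d} \<longrightarrow>
               h d - h c \<ge> - \<epsilon> * (d - c)))" for t
    proof (cases "t \<in> N")
      case True
      then show ?thesis using U(1,2) by (auto simp: open_contains_ball)
    next
      case False
      show ?thesis
      proof (cases "t \<in> {a..b}")
        case True
        then obtain D where "D \<ge> 0" "(h has_real_derivative D) (at t within {a..b})"
          using deriv \<open>t \<notin> N\<close> by blast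
        from nonneg_derivative_lower_bound_nearby[OF this(2,1) \<open>\<epsilon> > 0\<close>] \<open>t \<notin> N\<close>
        show ?thesis by metis
      qed (use \<open>t \<notin> N\<close> in \<open>auto intro: exI[of _ 1]\<close>)
    qed
    then obtain r where r: "\<And>t. r t > 0" "\<And>t. t \<in> N \<Longrightarrow> ball t (r t) \<subseteq> U"
      "\<And>t c d. t \<in> {a..b} - N \<Longrightarrow> c \<in> {a..b} \<Longrightarrow> d \<in> {a..b} \<Longrightarrow> {c..d} \<subseteq> ball t (r t) \<Longrightarrow>
         t \<in> {c..d} \<Longrightarrow> h d - h c \<ge> - \<epsilon> * (d - c)"
      by metis
    have "gauge (\<lambda>t. ball t (r t))" using r(1) by (auto simp: gauge_def)
    then obtain p where p: "p tagged_division_of {a..b}" and fine: "(\<lambda>t. ball t (r t)) fine p"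
      by (rule fine_division_exists_real)
    have "finite p" by (rule tagged_division_ofD(1)[OF p])
    have piece: "t \<in> K \<and> K = {Inf K..Sup K} \<and> Inf K \<le> Sup K \<and> Inf K \<in> {a..b} \<and> Sup K \<in> {a..b} \<and>
        K \<subseteq> ball t (r t) \<and> t \<in> {a..b}" if "(t, K) \<in> p" for t K
    proof -
      have "K \<in> snd ` p" using that by force
      note division_of_real_interval[OF division_of_tagged_division[OF p] subset_refl this]
      moreover have "t \<in> K" "K \<subseteq> {a..b}"
        by (rule tagged_division_ofD(2,3)[OF p that])+
      moreover have "K \<subseteq> ball t (r t)" using fine that by (rule fineD)
      ultimately show ?thesis by (intro conjI) (assumption | erule subsetD)+
    qed
    define q where "q = {(t, K) \<in> p. t \<in> N}"
    have "q \<subseteq> p" by (auto simp: q_def)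
    have bad: "(\<Sum>(t, K)\<in>q. h (Sup K) - h (Inf K)) \<ge> - \<epsilon>"
    proof -
      let ?\<D> = "snd ` q"
      have q: "q tagged_division_of \<Union>?\<D>"
        by (rule tagged_partial_division_of_Union_self[OF
              tagged_partial_division_subset[OF conjunct1[OF p[unfolded tagged_division_of_def]] \<open>q \<subseteq> p\<close>]])
      have div: "?\<D> division_of \<Union>?\<D>" by (rule division_of_tagged_division[OF q])
      have sub: "\<Union>?\<D> \<subseteq> {a..b}"
      proof (rule UN_least, clarify)
        fix t K s assume "(t, K) \<in> q" "s \<in> snd (t, K)"
        then show "s \<in> {a..b}" using tagged_division_ofD(3)[OF p, of t K] by (auto simp: q_def)
      qed
      have "(\<Sum>K\<in>?\<D>. Sup K - Inf K) = (\<Sum>K\<in>?\<D>. measure lebesgue K)"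
      proof (rule sum.cong[OF refl])
        fix K assume "K \<in> ?\<D>"
        from division_of_real_interval[OF div sub this]
        have "Inf K \<le> Sup K" "K = {Inf K..Sup K}" by simp_all
        moreover from this(1) have "measure lebesgue {Inf K..Sup K} = Sup K - Inf K" by simp
        ultimately show "Sup K - Inf K = measure lebesgue K" by simp
      qed
      also have "\<dots> = measure lebesgue (\<Union>?\<D>)" by (rule content_division[OF div])
      also have "\<dots> \<le> measure lebesgue U"
      proof (rule measure_mono_fmeasurable)
        show "\<Union>?\<D> \<subseteq> U"
        proof (rule UN_least, clarsimp)
          fix t K s assume "(t, K) \<in> q" "s \<in> K"
          then have "s \<in> ball t (r t)" "t \<in> N" using piece[of t K] by (auto simp: q_def)
          then show "s \<in> U" using r(2) by blast
        qed
      qed (rule fmeasurableD[OF lmeasurable_division[OF div]], rule U(3))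
      also have "\<dots> < \<delta>" by (rule U)
      finally have small: "(\<Sum>K\<in>?\<D>. norm (h (Sup K) - h (Inf K))) < \<epsilon>"
        using div sub \<delta> by blast
      \<comment> \<open>One degenerate interval may carry several tags, so passing from tagged intervals to intervals
        needs a summand that vanishes on degenerate ones; the empty set has to be included there, and
        \<open>Sup {}\<close>, \<open>Inf {}\<close> are unspecified.\<close>
      define \<phi> where "\<phi> K = (if interior K = {} then 0 else norm (h (Sup K) - h (Inf K)))" for K
      have \<phi>: "\<phi> K = norm (h (Sup K) - h (Inf K))" if "K \<in> ?\<D>" for K
      proof (cases "Inf K = Sup K")
        case False
        note K = division_of_real_interval[OF div sub that]
        have "interior K = {Inf K<..<Sup K}"
          by (subst K(4)) (rule interior_atLeastAtMost_real)
        then show ?thesis using K(1) False by (simp add: \<phi>_def)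
      qed (simp add: \<phi>_def)
      have "(\<Sum>(t, K)\<in>q. norm (h (Sup K) - h (Inf K))) = (\<Sum>(t, K)\<in>q. \<phi> K)"
        by (rule sum.cong[OF refl]) (clarify, subst \<phi>, force, rule refl)
      also have "\<dots> = sum \<phi> ?\<D>"
        by (rule sum.over_tagged_division_lemma[OF q]) (simp add: \<phi>_def)
      also have "\<dots> < \<epsilon>" using small by (simp only: sum.cong[OF refl \<phi>])
      finally have "(\<Sum>(t, K)\<in>q. norm (h (Sup K) - h (Inf K))) < \<epsilon>" .
      moreover have "(\<Sum>(t, K)\<in>q. - norm (h (Sup K) - h (Inf K))) \<le> (\<Sum>(t, K)\<in>q. h (Sup K) - h (Inf K))"
        by (rule sum_mono) auto
      ultimately show ?thesis by (simp add: case_prod_unfold sum_negf)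
    qed
    have good: "(\<Sum>(t, K)\<in>p - q. h (Sup K) - h (Inf K)) \<ge> - \<epsilon> * (b - a)"
    proof -
      have lower: "(\<Sum>(t, K)\<in>p - q. - \<epsilon> * (Sup K - Inf K)) \<le> (\<Sum>(t, K)\<in>p - q. h (Sup K) - h (Inf K))"
      proof (rule sum_mono, clarify)
        fix t K assume "(t, K) \<in> p" "(t, K) \<notin> q"
        then have "t \<notin> N" by (auto simp: q_def)
        then show "- \<epsilon> * (Sup K - Inf K) \<le> h (Sup K) - h (Inf K)"
          using piece[OF \<open>(t, K) \<in> p\<close>] r(3)[of t "Inf K" "Sup K"] by auto
      qed
      have "(\<Sum>(t, K)\<in>p - q. Sup K - Inf K) \<le> (\<Sum>(t, K)\<in>p. Sup K - Inf K)"
        using \<open>finite p\<close> piece by (intro sum_mono2) auto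
      moreover have "(\<Sum>(t, K)\<in>p. Sup K - Inf K) = b - a"
        using additive_tagged_division_1[OF \<open>a \<le> b\<close> p, of id] by simp
      ultimately have "(\<Sum>(t, K)\<in>p - q. Sup K - Inf K) \<le> b - a" by simp
      then have "- \<epsilon> * (b - a) \<le> - \<epsilon> * (\<Sum>(t, K)\<in>p - q. Sup K - Inf K)"
        using \<open>\<epsilon> > 0\<close> by simp
      also have "\<dots> = (\<Sum>(t, K)\<in>p - q. - \<epsilon> * (Sup K - Inf K))"
        by (simp only: sum_distrib_left case_prod_unfold)
      also note lower
      finally show ?thesis .
    qed
    have "h b - h a = (\<Sum>(t, K)\<in>p. h (Sup K) - h (Inf K))"
      using additive_tagged_division_1[OF \<open>a \<le> b\<close> p, of h] by simp
    also have "\<dots> = (\<Sum>(t, K)\<in>p - q. h (Sup K) - h (Inf K)) + (\<Sum>(t, K)\<in>q. h (Sup K) - h (Inf K))"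
      by (rule sum.subset_diff[OF \<open>q \<subseteq> p\<close> \<open>finite p\<close>])
    finally show ?thesis using good bad by linarith
  qed
  show ?thesis
  proof (rule ccontr)
    assume gt: "\<not> h a \<le> h b"
    define \<epsilon> where "\<epsilon> = (h a - h b) / (2 * (b - a + 1))"
    have "\<epsilon> > 0" and \<epsilon>: "2 * (\<epsilon> * (b - a + 1)) = h a - h b"
      using gt \<open>a \<le> b\<close> by (simp_all add: \<epsilon>_def divide_simps)
    have "h a - h b \<le> \<epsilon> * (b - a + 1)"
      using almost[OF \<open>\<epsilon> > 0\<close>] by (simp add: algebra_simps)
    then show False using \<epsilon> gt by linarith
  qed
qed

text \<open>
  The difference from a primitive of \<open>g\<close> is absolutely continuous with almost everywhere vanishing
  derivative, hence constant by monotonicity in both directions. This applies to the first component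
  of a trajectory, whose derivative is the continuous second component.
\<close>

lemma abs_continuous_on_has_continuous_derivative:
  fixes h g :: "real \<Rightarrow> real"
  assumes h: "abs_continuous_on a b h" and N: "negligible N" and g: "continuous_on {a..b} g"
    and deriv: "\<And>t. t \<in> {a..b} - N \<Longrightarrow> (h has_real_derivative g t) (at t within {a..b})"
    and t: "t \<in> {a..b}"
  shows "(h has_real_derivative g t) (at t within {a..b})"
proof -
  define G where "G s = integral {a..s} g" for s
  have G: "(G has_real_derivative g s) (at s within {a..b})" if "s \<in> {a..b}" for s
    unfolding G_def using integral_has_real_derivative[OF g that] .
  then have acG: "abs_continuous_on a b G"
    using g by (intro C1_imp_abs_continuous_on) (auto simp: has_real_derivative_iff_has_vector_derivative)
  have const: "h s - G s = h a - G a" if s: "s \<in> {a..b}" for s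
  proof (rule antisym)
    have sub: "{a..s} \<subseteq> {a..b}" and "a \<le> s" using s by auto
    have ac: "abs_continuous_on a s h" "abs_continuous_on a s G"
      using h acG sub abs_continuous_on_subset by blast+
    have zero: "((\<lambda>t. h t - G t) has_real_derivative 0) (at t within {a..s})"
      "((\<lambda>t. G t - h t) has_real_derivative 0) (at t within {a..s})" if "t \<in> {a..s} - N" for t
    proof -
      have "t \<in> {a..b} - N" using that sub by blast
      then have "(h has_real_derivative g t) (at t within {a..s})"
        "(G has_real_derivative g t) (at t within {a..s})"
        using deriv G sub by (blast intro: DERIV_subset)+
      from DERIV_diff[OF this] DERIV_diff[OF this(2,1)]
      show "((\<lambda>t. h t - G t) has_real_derivative 0) (at t within {a..s})"
        "((\<lambda>t. G t - h t) has_real_derivative 0) (at t within {a..s})" by simp_all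
    qed
    show "h a - G a \<le> h s - G s"
      by (rule abs_continuous_on_nondecreasing[OF abs_continuous_on_diff[OF ac] N \<open>a \<le> s\<close>])
        (use zero(1) in blast)
    have "G a - h a \<le> G s - h s"
      by (rule abs_continuous_on_nondecreasing[OF abs_continuous_on_diff[OF ac(2,1)] N \<open>a \<le> s\<close>])
        (use zero(2) in blast)
    then show "h s - G s \<le> h a - G a" by simp
  qed
  have "((\<lambda>s. G s + (h a - G a)) has_real_derivative g t) (at t within {a..b})"
    using DERIV_add[OF G[OF t] DERIV_const] by simp
  then show ?thesis
    by (rule has_field_derivative_transform_within[where d = 1]) (use t const in \<open>auto simp: algebra_simps\<close>)
qed

section \<open>Sturm comparison for bounded controls\<close>

lemma AE_lebesgue_on_iff_negligible:
  assumes "S \<in> sets lebesgue"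
  shows "(AE t in lebesgue_on S. P t) \<longleftrightarrow> (\<exists>N. negligible N \<and> (\<forall>t\<in>S - N. P t))"
proof -
  have "(AE t in lebesgue_on S. P t) \<longleftrightarrow> (AE t in lebesgue. t \<in> S \<longrightarrow> P t)"
    using assms by (intro AE_restrict_space_iff) simp
  also have "\<dots> \<longleftrightarrow> (\<exists>N. negligible N \<and> (\<forall>t\<in>S - N. P t))"
    unfolding eventually_ae_filter_negligible by blast
  finally show ?thesis .
qed

text \<open>
  A trajectory \<open>x\<close> is compared with a positive solution \<open>y\<close> of \<open>y'' = - v y\<close>, that is, of the equation for
  the constant control \<open>v\<close>.
\<close>

locale sturm_comparison =
  fixes a b v :: real and u :: "real \<Rightarrow> real" and x :: "real \<Rightarrow> real \<times> real" and N :: "real set"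
    and y y' :: "real \<Rightarrow> real"
  assumes less: "a < b"
    and ac: "abs_continuous_on a b x"
    and null: "negligible N"
    and ode: "\<And>t. t \<in> {a..b} - N \<Longrightarrow>
      (x has_vector_derivative f_field (x t) + u t *\<^sub>R g_field (x t)) (at t within {a..b})"
    and pos: "\<And>t. t \<in> {a..b} \<Longrightarrow> fst (x t) > 0"
    and y: "\<And>t. t \<in> {a..b} \<Longrightarrow> (y has_real_derivative y' t) (at t within {a..b})"
    and y': "\<And>t. t \<in> {a..b} \<Longrightarrow> (y' has_real_derivative - v * y t) (at t within {a..b})"
    and y_pos: "\<And>t. t \<in> {a..b} \<Longrightarrow> y t > 0"
begin

definition wronskian :: "real \<Rightarrow> real" where
  "wronskian t = snd (x t) * y t - fst (x t) * y' t"

lemma ode_components: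
  assumes "t \<in> {a..b} - N"
  shows "((\<lambda>t. fst (x t)) has_real_derivative snd (x t)) (at t within {a..b})"
    and "((\<lambda>t. snd (x t)) has_real_derivative - u t * fst (x t)) (at t within {a..b})"
  using bounded_linear.has_vector_derivative[OF bounded_linear_fst ode[OF assms]]
    bounded_linear.has_vector_derivative[OF bounded_linear_snd ode[OF assms]]
  by (simp_all add: has_real_derivative_iff_has_vector_derivative f_field_def g_field_def)

lemma position_has_derivative:
  assumes "t \<in> {a..b}"
  shows "((\<lambda>t. fst (x t)) has_real_derivative snd (x t)) (at t within {a..b})"
  by (rule abs_continuous_on_has_continuous_derivative[OF abs_continuous_on_fst_snd(1)[OF ac] null
        abs_continuous_on_imp_continuous_on[OF abs_continuous_on_fst_snd(2)[OF ac]]])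
    (use ode_components assms in auto)

lemma continuous_comparison: "continuous_on {a..b} y" "continuous_on {a..b} y'"
  by (rule DERIV_continuous_on, erule y, rule DERIV_continuous_on, erule y')

lemma wronskian_abs_continuous: "abs_continuous_on a b wronskian"
proof -
  have "abs_continuous_on a b y" "abs_continuous_on a b y'"
    by (rule C1_imp_abs_continuous_on, erule y[unfolded has_real_derivative_iff_has_vector_derivative],
        rule continuous_comparison,
        rule C1_imp_abs_continuous_on, erule y'[unfolded has_real_derivative_iff_has_vector_derivative],
        intro continuous_intros continuous_comparison)
  then show ?thesis
    unfolding wronskian_def[abs_def]
    by (intro abs_continuous_on_diff abs_continuous_on_mult abs_continuous_on_fst_snd[OF ac])
qed

text \<open>
  The sign of \<open>v - u\<close> decides the monotonicity of the Wronskian, because both positions are positive.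
  The extreme controls \<open>v = - 1\<close> and \<open>v = 1\<close> thus give comparisons with every admissible control, in
  opposite time directions: nonpositivity spreads forward from \<open>a\<close> when \<open>v \<le> u\<close>, and backward
  from \<open>b\<close> when \<open>u \<le> v\<close>.
\<close>

lemma wronskian_has_derivative:
  assumes "t \<in> {a..b} - N"
  shows "(wronskian has_real_derivative (v - u t) * (fst (x t) * y t)) (at t within {a..b})"
proof -
  have t: "t \<in> {a..b}" using assms by blast
  have "((\<lambda>t. snd (x t) * y t - fst (x t) * y' t) has_real_derivative
      (- u t * fst (x t)) * y t + y' t * snd (x t)
        - (snd (x t) * y' t + (- v * y t) * fst (x t))) (at t within {a..b})"
    by (intro DERIV_diff DERIV_mult ode_components[OF assms] y[OF t] y'[OF t])
  then show ?thesis
    unfolding wronskian_def[abs_def] by (simp add: algebra_simps)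
qed

lemma wronskian_nonpos_forward:
  assumes "\<And>t. t \<in> {a..b} \<Longrightarrow> v \<le> u t" and "wronskian a \<le> 0" and t: "t \<in> {a..b}"
  shows "wronskian t \<le> 0"
proof -
  have "0 - wronskian a \<le> 0 - wronskian t"
  proof (rule abs_continuous_on_nondecreasing[OF _ null, of a t "\<lambda>t. 0 - wronskian t"])
    have "abs_continuous_on a b (\<lambda>_. 0::real)"
      by (rule C1_imp_abs_continuous_on[of _ _ _ "\<lambda>_. 0"]) auto
    then show "abs_continuous_on a t (\<lambda>t. 0 - wronskian t)"
      using t by (intro abs_continuous_on_subset[OF abs_continuous_on_diff[OF _ wronskian_abs_continuous]]) auto
    fix s assume s: "s \<in> {a..t} - N"
    then have s': "s \<in> {a..b} - N" using t by auto
    have "((\<lambda>t. 0 - wronskian t) has_real_derivative 0 - (v - u s) * (fst (x s) * y s)) (at s within {a..t})"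
      using t by (intro DERIV_diff DERIV_const DERIV_subset[OF wronskian_has_derivative[OF s']]) auto
    moreover have "0 - (v - u s) * (fst (x s) * y s) \<ge> 0"
      using assms(1)[of s] pos[of s] y_pos[of s] s' by (simp add: mult_nonpos_nonneg)
    ultimately show "\<exists>D\<ge>0. ((\<lambda>t. 0 - wronskian t) has_real_derivative D) (at s within {a..t})"
      by blast
  qed (use t in auto)
  then show ?thesis using assms(2) by simp
qed

lemma wronskian_nonpos_backward:
  assumes "\<And>t. t \<in> {a..b} \<Longrightarrow> u t \<le> v" and "wronskian b \<le> 0" and t: "t \<in> {a..b}"
  shows "wronskian t \<le> 0"
proof -
  have "wronskian t \<le> wronskian b"
  proof (rule abs_continuous_on_nondecreasing[OF _ null, of t b wronskian])
    show "abs_continuous_on t b wronskian"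
      using t by (intro abs_continuous_on_subset[OF wronskian_abs_continuous]) auto
    fix s assume s: "s \<in> {t..b} - N"
    then have s': "s \<in> {a..b} - N" using t by auto
    have "(wronskian has_real_derivative (v - u s) * (fst (x s) * y s)) (at s within {t..b})"
      using t by (intro DERIV_subset[OF wronskian_has_derivative[OF s']]) auto
    moreover have "(v - u s) * (fst (x s) * y s) \<ge> 0"
      using assms(1)[of s] pos[of s] y_pos[of s] s' by simp
    ultimately show "\<exists>D\<ge>0. (wronskian has_real_derivative D) (at s within {t..b})"
      by blast
  qed (use t in auto)
  then show ?thesis using assms(2) by simp
qed

text \<open>
  The quotient rule gives \<open>(x\<^sub>1 / y)' = wronskian / y\<^sup>2\<close>.
\<close>

lemma ratio_nonincreasing:
  assumes W: "\<And>t. t \<in> {a..b} \<Longrightarrow> wronskian t \<le> 0" and "s \<in> {a..b}" "t \<in> {a..b}" "s \<le> t"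
  shows "fst (x t) / y t \<le> fst (x s) / y s"
proof (rule DERIV_nonpos_imp_decreasing_open[OF \<open>s \<le> t\<close>, of "\<lambda>t. fst (x t) / y t"])
  have quotient: "((\<lambda>t. fst (x t) / y t) has_real_derivative wronskian r / (y r * y r)) (at r within {a..b})"
    if "r \<in> {a..b}" for r
    using DERIV_divide[OF position_has_derivative[OF that] y[OF that]] y_pos[OF that]
    by (simp add: wronskian_def)
  show "continuous_on {s..t} (\<lambda>t. fst (x t) / y t)"
    by (rule continuous_on_subset[OF DERIV_continuous_on[OF quotient]]) (use assms(2,3) in auto)
  fix r assume r: "s < r" "r < t"
  then have "r \<in> {a<..<b}" using assms(2,3) by auto
  then have "at r within {a..b} = at r" by (intro at_within_interior) auto
  moreover have "r \<in> {a..b}" using \<open>r \<in> {a<..<b}\<close> by auto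
  ultimately show "\<exists>D. ((\<lambda>t. fst (x t) / y t) has_real_derivative D) (at r) \<and> D \<le> 0"
    using quotient[of r] W[of r] by (metis divide_nonpos_nonneg zero_le_square)
qed

text \<open>
  Equal ratios at both ends force the nonincreasing ratio to be constant. Differentiating
  \<open>x\<^sub>1 = k y\<close> once yields the second component, and differentiating once more yields the control
  wherever the differential equation holds.
\<close>

lemma ratio_rigidity:
  assumes W: "\<And>t. t \<in> {a..b} \<Longrightarrow> wronskian t \<le> 0"
    and ends: "fst (x a) = k * y a" "fst (x b) = k * y b" and t: "t \<in> {a..b}"
  shows "x t = (k * y t, k * y' t)" and "t \<notin> N \<Longrightarrow> u t = v"
proof -
  have first: "fst (x s) = k * y s" if "s \<in> {a..b}" for s
  proof -
    have "fst (x s) / y s \<le> k" "k \<le> fst (x s) / y s"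
      using ratio_nonincreasing[OF W, of a s] ratio_nonincreasing[OF W, of s b] that less
        ends y_pos[of a] y_pos[of b] by simp_all
    then show ?thesis using y_pos[OF that] by (simp add: field_simps)
  qed
  have second: "snd (x s) = k * y' s" if "s \<in> {a..b}" for s
  proof (rule vector_derivative_unique_within_closed_interval[OF less])
    show "((\<lambda>t. fst (x t)) has_vector_derivative snd (x s)) (at s within cbox a b)"
      using position_has_derivative[OF that]
      by (simp add: has_real_derivative_iff_has_vector_derivative)
    have "((\<lambda>t. k * y t) has_real_derivative k * y' s) (at s within {a..b})"
      by (rule DERIV_cmult[OF y[OF that]])
    then have "((\<lambda>t. fst (x t)) has_real_derivative k * y' s) (at s within {a..b})"
      by (rule has_field_derivative_transform_within[where d = 1]) (use that first in auto)
    then show "((\<lambda>t. fst (x t)) has_vector_derivative k * y' s) (at s within cbox a b)"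
      by (simp add: has_real_derivative_iff_has_vector_derivative)
  qed (use that in simp)
  show "x t = (k * y t, k * y' t)"
    using first[OF t] second[OF t] by (simp add: prod_eq_iff)
  show "u t = v" if "t \<notin> N"
  proof -
    have "((\<lambda>t. snd (x t)) has_real_derivative - u t * fst (x t)) (at t within {a..b})"
      using ode_components(2) t that by simp
    moreover have "((\<lambda>t. k * y' t) has_real_derivative k * (- v * y t)) (at t within {a..b})"
      by (rule DERIV_cmult[OF y'[OF t]])
    then have "((\<lambda>t. snd (x t)) has_real_derivative k * (- v * y t)) (at t within {a..b})"
      by (rule has_field_derivative_transform_within[where d = 1]) (use t second in auto)
    ultimately have "- u t * fst (x t) = k * (- v * y t)"
      using vector_derivative_unique_within_closed_interval[OF less, of t "\<lambda>t. snd (x t)"] t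
      unfolding has_real_derivative_iff_has_vector_derivative cbox_interval by blast
    then have "(u t - v) * fst (x t) = 0" using first[OF t] by (simp add: algebra_simps)
    then show ?thesis using pos[OF t] by simp
  qed
qed

end

section \<open>Optimality of the bang-bang control\<close>

text \<open>
  The time \<open>r = T - \<tau>\<close> is where the two comparisons meet: \<open>\<gamma> * cos \<tau> \<le> x\<^sub>1 r \<le> cosh r\<close>. The matching
  condition turns this into \<open>cosh S \<le> cosh r\<close>, so \<open>T \<le> S + \<tau>\<close> leaves only \<open>r = S\<close> with equality in both
  comparisons, and rigidity then determines both arcs.
\<close>

lemma feasible_within_bound_is_extremal:
  assumes feas: "feasible \<gamma> T u x" and "S > 0" "0 < \<tau>" "\<tau> < pi / 2"
    and match: "cosh S = \<gamma> * cos \<tau>" and "T \<le> S + \<tau>"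
  shows "T = S + \<tau>"
    and "\<And>t. t \<in> {0..S} \<Longrightarrow> x t = (cosh t, sinh t)"
    and "\<And>t. t \<in> {S..T} \<Longrightarrow> x t = (\<gamma> * cos (T - t), \<gamma> * sin (T - t))"
    and "AE t in lebesgue_on {0..T}. u t = (if t < S then - 1 else 1)"
proof -
  have "T > 0" and u: "\<And>t. t \<in> {0..T} \<Longrightarrow> - 1 \<le> u t \<and> u t \<le> 1"
    and ac: "abs_continuous_on 0 T x" and x0: "x 0 = (1, 0)" and xT: "x T = (\<gamma>, 0)"
    and pos: "\<And>t. t \<in> {0..T} \<Longrightarrow> fst (x t) > 0"
    using feas by (auto simp: feasible_def admissible_def trajectory_def state_space_def)
  obtain N where N: "negligible N" and ode: "\<And>t. t \<in> {0..T} - N \<Longrightarrow>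
      (x has_vector_derivative f_field (x t) + u t *\<^sub>R g_field (x t)) (at t within {0..T})"
    using feas by (auto simp: feasible_def trajectory_def AE_lebesgue_on_iff_negligible)
  have "\<gamma> > 0" using pos[of T] xT \<open>T > 0\<close> by simp
  have cos_pos: "cos \<tau> > 0" using \<open>0 < \<tau>\<close> \<open>\<tau> < pi / 2\<close> by (intro cos_gt_zero_pi) auto
  have hyperbolic: "sturm_comparison 0 r (- 1) u x N cosh sinh" if "0 < r" "r \<le> T" for r
  proof
    show "abs_continuous_on 0 r x" by (rule abs_continuous_on_subset[OF ac]) (use that in auto)
    show "(x has_vector_derivative f_field (x t) + u t *\<^sub>R g_field (x t)) (at t within {0..r})"
      if t: "t \<in> {0..r} - N" for t
      by (rule has_vector_derivative_within_subset[OF ode]) (use t \<open>r \<le> T\<close> in auto)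
  qed (use that N pos in \<open>auto intro!: derivative_eq_intros\<close>)
  have trigonometric: "sturm_comparison r T 1 u x N (\<lambda>t. cos (T - t)) (\<lambda>t. sin (T - t))"
    if "0 \<le> r" "r < T" "T - r \<le> \<tau>" for r
  proof
    show "abs_continuous_on r T x" by (rule abs_continuous_on_subset[OF ac]) (use that in auto)
    show "(x has_vector_derivative f_field (x t) + u t *\<^sub>R g_field (x t)) (at t within {r..T})"
      if t: "t \<in> {r..T} - N" for t
      by (rule has_vector_derivative_within_subset[OF ode]) (use t \<open>0 \<le> r\<close> in auto)
    show "0 < cos (T - t)" if "t \<in> {r..T}" for t
      using that \<open>T - r \<le> \<tau>\<close> \<open>\<tau> < pi / 2\<close> by (intro cos_gt_zero_pi) auto
  qed (use that N pos in \<open>auto intro!: derivative_eq_intros\<close>)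
  have last_arc: "sturm_comparison.wronskian x (\<lambda>t. cos (T - t)) (\<lambda>t. sin (T - t)) t \<le> 0"
    if "0 \<le> r" "r < T" "T - r \<le> \<tau>" "t \<in> {r..T}" for r t
  proof -
    interpret sturm_comparison r T 1 u x N "\<lambda>t. cos (T - t)" "\<lambda>t. sin (T - t)"
      by (rule trigonometric) (use that in auto)
    show ?thesis
      by (rule wronskian_nonpos_backward) (use that u xT in \<open>auto simp: wronskian_def\<close>)
  qed
  have lower: "\<gamma> * cos (T - r) \<le> fst (x r)" if "0 \<le> r" "r < T" "T - r \<le> \<tau>" for r
  proof -
    interpret sturm_comparison r T 1 u x N "\<lambda>t. cos (T - t)" "\<lambda>t. sin (T - t)"
      by (rule trigonometric) (use that in auto)
    have "fst (x T) / cos (T - T) \<le> fst (x r) / cos (T - r)"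
      by (rule ratio_nonincreasing) (use that last_arc in auto)
    then show ?thesis using xT y_pos[of r] that by (simp add: field_simps)
  qed
  \<comment> \<open>Otherwise the backward comparison would reach time \<open>0\<close> and demand a starting position of at
    least \<open>cosh S > 1\<close>.\<close>
  have "\<tau> < T"
  proof (rule ccontr)
    assume "\<not> \<tau> < T"
    then have "cos \<tau> \<le> cos T"
      using \<open>T > 0\<close> \<open>\<tau> < pi / 2\<close> by (intro cos_monotone_0_pi_le) auto
    then have "cosh S \<le> \<gamma> * cos T" using match \<open>\<gamma> > 0\<close> by simp
    also have "\<dots> \<le> 1" using lower[of 0] \<open>T > 0\<close> \<open>\<not> \<tau> < T\<close> x0 by simp
    finally show False using cosh_real_nonneg_less_iff[of 0 S] \<open>S > 0\<close> by simp
  qed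
  define r where "r = T - \<tau>"
  have r: "0 < r" "r < T" "T - r = \<tau>" "r \<le> S"
    using \<open>\<tau> < T\<close> \<open>0 < \<tau>\<close> \<open>T \<le> S + \<tau>\<close> by (auto simp: r_def)
  interpret X: sturm_comparison 0 r "- 1" u x N cosh sinh
    by (rule hyperbolic) (use r in auto)
  interpret Y: sturm_comparison r T 1 u x N "\<lambda>t. cos (T - t)" "\<lambda>t. sin (T - t)"
    by (rule trigonometric) (use r in auto)
  have WX: "X.wronskian t \<le> 0" if "t \<in> {0..r}" for t
    by (rule X.wronskian_nonpos_forward) (use that u x0 r in \<open>auto simp: X.wronskian_def\<close>)
  have WY: "Y.wronskian t \<le> 0" if "t \<in> {r..T}" for t
    by (rule last_arc) (use that r in auto)
  have upper: "fst (x r) \<le> cosh r"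
    using X.ratio_nonincreasing[OF WX, of 0 r] r x0 by (simp add: field_simps)
  have "cosh S \<le> cosh r" using lower[of r] upper match r by simp
  then have "S = r" using cosh_real_nonneg_le_iff[of S r] r \<open>S > 0\<close> by simp
  then have switch: "fst (x r) = cosh r" "fst (x r) = \<gamma> * cos (T - r)"
    using lower[of r] upper match r by simp_all
  show "T = S + \<tau>" using \<open>S = r\<close> r by simp
  show "x t = (cosh t, sinh t)" if "t \<in> {0..S}" for t
    using X.ratio_rigidity(1)[OF WX, of 1 t] that x0 switch \<open>S = r\<close> by simp
  show "x t = (\<gamma> * cos (T - t), \<gamma> * sin (T - t))" if "t \<in> {S..T}" for t
    using Y.ratio_rigidity(1)[OF WY, of \<gamma> t] that xT switch \<open>S = r\<close> by simp
  have "u t = (if t < S then - 1 else 1)" if "t \<in> {0..T} - N" for t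
    using X.ratio_rigidity(2)[OF WX, of 1 t] Y.ratio_rigidity(2)[OF WY, of \<gamma> t]
      that x0 xT switch \<open>S = r\<close> by (cases "t < r") auto
  then show "AE t in lebesgue_on {0..T}. u t = (if t < S then - 1 else 1)"
    using N by (auto simp: AE_lebesgue_on_iff_negligible)
qed

text \<open>
  Both arcs pass through the switching point \<open>(\<gamma> * cos \<tau>, \<gamma> * sin \<tau>)\<close>, the intersection of the hyperbola
  \<open>x\<^sub>1\<^sup>2 - x\<^sub>2\<^sup>2 = 1\<close> through \<open>(1, 0)\<close> with the circle \<open>x\<^sub>1\<^sup>2 + x\<^sub>2\<^sup>2 = \<gamma>\<^sup>2\<close> through \<open>(\<gamma>, 0)\<close>. Adding and subtracting
  the two equations gives \<open>x\<^sub>2\<^sup>2 = (\<gamma>\<^sup>2 - 1) / 2\<close>.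
\<close>

lemma switching_times:
  fixes \<gamma> :: real
  assumes "\<gamma> > 1"
  defines "S \<equiv> arsinh (sqrt ((\<gamma>\<^sup>2 - 1) / 2))"
    and "\<tau> \<equiv> arcsin (1 / \<gamma> * sqrt ((\<gamma>\<^sup>2 - 1) / 2))"
  shows "S > 0" "0 < \<tau>" "\<tau> < pi / 2" "cosh S = \<gamma> * cos \<tau>" "sinh S = \<gamma> * sin \<tau>"
proof -
  let ?q = "sqrt ((\<gamma>\<^sup>2 - 1) / 2)"
  have sq: "\<gamma>\<^sup>2 > 1" using assms(1) by (simp add: one_less_power)
  then have "?q > 0" and q2: "?q\<^sup>2 = (\<gamma>\<^sup>2 - 1) / 2" by simp_all
  have "?q < \<gamma>"
  proof (rule power2_less_imp_less)
    have "(\<gamma>\<^sup>2 - 1) / 2 < \<gamma>\<^sup>2" using sq by argo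
    then show "?q\<^sup>2 < \<gamma>\<^sup>2" unfolding q2 .
  qed (use assms(1) in simp)
  then have arg: "0 < 1 / \<gamma> * ?q" "1 / \<gamma> * ?q < 1"
    using \<open>?q > 0\<close> assms(1) by (simp_all add: field_simps)
  show "S > 0" using \<open>?q > 0\<close> by (simp add: S_def)
  show "0 < \<tau>" "\<tau> < pi / 2"
    using arcsin_less_mono[of 0 "1 / \<gamma> * ?q"] arcsin_less_mono[of "1 / \<gamma> * ?q" 1] arg
    by (simp_all add: \<tau>_def)
  have sin: "sin \<tau> = 1 / \<gamma> * ?q"
    unfolding \<tau>_def by (rule sin_arcsin) (use arg in auto)
  then show sinh: "sinh S = \<gamma> * sin \<tau>" using assms(1) by (simp add: S_def)
  have "cos \<tau> > 0"
    using \<open>0 < \<tau>\<close> \<open>\<tau> < pi / 2\<close> by (intro cos_gt_zero_pi) auto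
  show "cosh S = \<gamma> * cos \<tau>"
  proof (rule power2_eq_imp_eq)
    have "(\<gamma> * sin \<tau>)\<^sup>2 = (\<gamma>\<^sup>2 - 1) / 2" using sin q2 assms(1) by simp
    moreover have "(\<gamma> * cos \<tau>)\<^sup>2 = \<gamma>\<^sup>2 - (\<gamma> * sin \<tau>)\<^sup>2"
      by (simp add: power_mult_distrib cos_squared_eq algebra_simps)
    ultimately show "(cosh S)\<^sup>2 = (\<gamma> * cos \<tau>)\<^sup>2"
      by (simp add: cosh_square_eq sinh field_simps)
  qed (use assms(1) \<open>cos \<tau> > 0\<close> in auto)
qed

lemma hyperbolic_arc_integral_curve:
  "((\<lambda>t. (cosh t, sinh t)) has_vector_derivative X_field (cosh t, sinh t)) (at t within A)"
proof -
  have "((\<lambda>t. (cosh t, sinh t)) has_vector_derivative (sinh t, cosh t)) (at t within A)"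
    by (intro has_vector_derivative_Pair)
      (auto simp flip: has_real_derivative_iff_has_vector_derivative intro!: derivative_eq_intros)
  then show ?thesis by (simp add: X_field_def f_field_def g_field_def)
qed

lemma circular_arc_integral_curve:
  "((\<lambda>t. (\<gamma> * cos (T - t), \<gamma> * sin (T - t))) has_vector_derivative
      Y_field (\<gamma> * cos (T - t), \<gamma> * sin (T - t))) (at t within A)"
proof -
  have "((\<lambda>t. (\<gamma> * cos (T - t), \<gamma> * sin (T - t))) has_vector_derivative
      (\<gamma> * sin (T - t), - (\<gamma> * cos (T - t)))) (at t within A)"
    by (intro has_vector_derivative_Pair)
      (auto simp flip: has_real_derivative_iff_has_vector_derivative intro!: derivative_eq_intros)
  then show ?thesis by (simp add: Y_field_def f_field_def g_field_def)
qed

lemma bang_bang_feasible: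
  assumes "S > 0" "0 < \<tau>" "\<tau> < pi / 2"
    and match: "cosh S = \<gamma> * cos \<tau>" "sinh S = \<gamma> * sin \<tau>"
  defines "T \<equiv> S + \<tau>"
  shows "feasible \<gamma> T (\<lambda>t. if t < S then - 1 else 1)
    (\<lambda>t. if t \<le> S then (cosh t, sinh t) else (\<gamma> * cos (T - t), \<gamma> * sin (T - t)))"
    (is "feasible \<gamma> T ?u ?x")
proof -
  let ?h = "\<lambda>t. (cosh t, sinh t)" and ?c = "\<lambda>t. (\<gamma> * cos (T - t), \<gamma> * sin (T - t))"
  have "T > 0" "S < T" using assms(1,2) by (simp_all add: T_def)
  have "cos \<tau> > 0" using assms(2,3) by (intro cos_gt_zero_pi) auto
  then have "\<gamma> > 0" using match(1) cosh_real_pos[of S] by (metis zero_less_mult_pos2)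
  have "abs_continuous_on 0 T ?x"
  proof -
    obtain L where L: "L-lipschitz_on {0..S} ?h"
      by (rule C1_imp_lipschitz_on[OF hyperbolic_arc_integral_curve])
        (auto simp: X_field_def f_field_def g_field_def intro!: continuous_intros)
    obtain M where M: "M-lipschitz_on {S..T} ?c"
      by (rule C1_imp_lipschitz_on[OF circular_arc_integral_curve])
        (auto simp: Y_field_def f_field_def g_field_def intro!: continuous_intros)
    have "(max L M)-lipschitz_on {0..T} ?x"
      by (rule lipschitz_on_concat_max[OF L M]) (simp add: match T_def)
    then show ?thesis by (rule lipschitz_imp_abs_continuous_on)
  qed
  moreover have "AE t in lebesgue_on {0..T}.
      (?x has_vector_derivative f_field (?x t) + ?u t *\<^sub>R g_field (?x t)) (at t within {0..T})"
    unfolding AE_lebesgue_on_iff_negligible[OF lmeasurable_cbox[THEN fmeasurableD, of 0 T, unfolded cbox_interval]]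
  proof (intro exI[of _ "{S}"] conjI ballI)
    show "negligible {S}" by simp
    fix t assume t: "t \<in> {0..T} - {S}"
    show "(?x has_vector_derivative f_field (?x t) + ?u t *\<^sub>R g_field (?x t)) (at t within {0..T})"
    proof (cases "t < S")
      case True
      have "(?x has_vector_derivative X_field (cosh t, sinh t)) (at t within {0..T})"
        by (rule has_vector_derivative_transform_within[OF hyperbolic_arc_integral_curve, of "S - t"])
          (use t True in \<open>auto simp: dist_real_def\<close>)
      then show ?thesis using True by (simp add: X_field_def)
    next
      case False
      then have "S < t" using t by auto
      have "(?x has_vector_derivative Y_field (?c t)) (at t within {0..T})"
        by (rule has_vector_derivative_transform_within[OF circular_arc_integral_curve, of "t - S"])
          (use t \<open>S < t\<close> in \<open>auto simp: dist_real_def\<close>)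
      then show ?thesis using \<open>S < t\<close> by (simp add: Y_field_def)
    qed
  qed
  moreover have "admissible T ?u"
    unfolding admissible_def by (auto intro!: measurable_restrict_space1 measurable_completion)
  moreover have "?x t \<in> state_space" if "t \<in> {0..T}" for t
  proof (cases "t \<le> S")
    case False
    then have "cos (T - t) > 0"
      using that assms(3) by (intro cos_gt_zero_pi) (auto simp: T_def)
    then show ?thesis using False \<open>\<gamma> > 0\<close> by (simp add: state_space_def)
  qed (simp add: state_space_def)
  ultimately show ?thesis
    using \<open>T > 0\<close> \<open>S < T\<close> \<open>S > 0\<close> by (auto simp: feasible_def trajectory_def)
qed

theorem theorem4:
  fixes \<gamma> T_X T_Y :: real and u_opt :: "real \<Rightarrow> real"
  assumes "\<gamma> > 1"
  defines "T_X \<equiv> arsinh (sqrt ((\<gamma>\<^sup>2 - 1) / 2))"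
    and "T_Y \<equiv> arcsin (1 / \<gamma> * sqrt ((\<gamma>\<^sup>2 - 1) / 2))"
    and "u_opt \<equiv> (\<lambda>t. if t < T_X then - 1 else 1)"
  shows "(\<exists>x. optimal \<gamma> (T_X + T_Y) u_opt x) \<and>
         (\<forall>T u x. optimal \<gamma> T u x \<longrightarrow>
            T = T_X + T_Y \<and>
            (AE t in lebesgue_on {0..T}. u t = u_opt t) \<and>
            XY_trajectory T_X T x)"
proof -
  note times = switching_times[OF assms(1), folded T_X_def T_Y_def]
  note extremal = feasible_within_bound_is_extremal[OF _ times(1-4)]
  have bound: "T_X + T_Y \<le> T" if "feasible \<gamma> T u x" for T u x
    using extremal(1)[OF that] by linarith
  obtain x0 where x0: "feasible \<gamma> (T_X + T_Y) u_opt x0"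
    using bang_bang_feasible[OF times] unfolding u_opt_def by blast
  have "optimal \<gamma> (T_X + T_Y) u_opt x0"
    using x0 bound unfolding optimal_def by blast
  moreover have "T = T_X + T_Y \<and> (AE t in lebesgue_on {0..T}. u t = u_opt t) \<and> XY_trajectory T_X T x"
    if opt: "optimal \<gamma> T u x" for T u x
  proof -
    have feas: "feasible \<gamma> T u x" and le: "T \<le> T_X + T_Y"
      using opt x0 unfolding optimal_def by blast+
    note ext = extremal[OF feas le]
    have "(x has_vector_derivative X_field (x t)) (at t within {0..T_X})" if "t \<in> {0..T_X}" for t
      unfolding ext(2)[OF that]
      by (rule has_vector_derivative_transform[OF that _ hyperbolic_arc_integral_curve]) (rule ext(2))
    moreover have "(x has_vector_derivative Y_field (x t)) (at t within {T_X..T})" if "t \<in> {T_X..T}" for t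
      unfolding ext(3)[OF that]
      by (rule has_vector_derivative_transform[OF that _ circular_arc_integral_curve]) (rule ext(3))
    ultimately have "XY_trajectory T_X T x"
      using times(1,2) ext(1) by (simp add: XY_trajectory_def integral_curve_def)
    then show ?thesis using ext(1,4) unfolding u_opt_def by blast
  qed
  ultimately show ?thesis by blast
qed

end
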